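(* Let $V\in C^2(\mathbb{R},\mathbb{R})$ satisfy $V(x)\ge0$ for all $x$, $V(-1)=V(1)=0$, $V(x)>0$ for $x\in(-1,1)$, and $V''(-1),V''(1)>0$. Let $a:\mathbb{R}\to\mathbb{R}$ be continuous and coercive, i.e. $\inf_{t\in\mathbb{R}}a(t)>0$ and $a(t)\to+\infty$ as $|t|\to+\infty$. Then for all $\epsilon>0$ the problem $\ddot x(t)=a(\epsilon t)V'(x(t))$, $t\in\mathbb{R}$, $x(t)\to-1$ as $t\to-\infty$, $x(t)\to1$ as $t\to+\infty$, has a solution $x\in H^1_{loc}(\mathbb{R})\cap C^2(\mathbb{R})$. Moreover, $x(t)\in(-1,1)$ for all $t\in\mathbb{R}$. *)

theory Defs
  imports Complex_Main
begin

definition C2_with :: "(real \<Rightarrow> real) \<Rightarrow> (real \<Rightarrow> real) \<Rightarrow> (real \<Rightarrow> real) \<Rightarrow> bool" where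
  "C2_with f f1 f2 \<longleftrightarrow>
     (\<forall>t. (f has_real_derivative f1 t) (at t)) \<and>
     (\<forall>t. (f1 has_real_derivative f2 t) (at t)) \<and>
     continuous_on UNIV f2"

end

theory Submission
  imports Defs "HOL-Analysis.Analysis"
begin

text \<open>Write \<open>b t = a (\<epsilon> t)\<close>. On the lattice of mesh \<open>1/n\<close> minimise the discrete action
  \<open>\<Sum> |\<Delta>x|\<^sup>2 / (2 \<Delta>t) + \<Delta>t b V(x)\<close> among \<open>[-1,1]\<close>-valued sequences equal to \<open>\<plusminus>1\<close> at times
  beyond \<open>\<plusminus>n\<close>. Minimisers exist by compactness, satisfy the discrete equation even where they touch
  \<open>\<plusminus>1\<close>, and have action bounded independently of \<open>n\<close>, by comparison with a linear ramp on \<open>[-1,1]\<close>.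
  Crossing an interval \<open>[\<alpha>,\<beta>] \<subseteq> (-1,1)\<close> far from time \<open>0\<close> costs more than this bound, because
  \<open>b \<rightarrow> \<infinity>\<close>; so the tails are near \<open>\<plusminus>1\<close> uniformly in \<open>n\<close>, and this survives in any locally
  uniform limit, which solves the differential equation. The limit omits the values \<open>\<plusminus>1\<close> because
  these are constant solutions.\<close>

subsection \<open>Limits of lattice functions\<close>

lemma eventually_real_gt:
  assumes "F \<le> sequentially"
  shows "\<forall>\<^sub>F n in F. real n > c"
  using filter_leD[OF assms, of "\<lambda>n. real n > c"] filterlim_real_sequentially
  by (simp add: filterlim_at_top_dense)

text \<open>The one-step errors add up. With \<open>c\<close> a slope divided by \<open>n\<close>,
  this compares a whole stretch of a lattice function with a straight line; \<open>c = 0\<close>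
  gives Lipschitz bounds.\<close>

lemma telescoping_deviation:
  fixes z :: "int \<Rightarrow> real"
  assumes "i \<le> j" "\<And>l. i \<le> l \<Longrightarrow> l < j \<Longrightarrow> \<bar>z (l + 1) - z l - c\<bar> \<le> e"
  shows "\<bar>z j - z i - of_int (j - i) * c\<bar> \<le> of_int (j - i) * e"
  using assms
proof (induction j rule: int_ge_induct)
  case base
  then show ?case by simp
next
  case (step j)
  have "\<bar>z j - z i - of_int (j - i) * c\<bar> \<le> of_int (j - i) * e"
    using step by simp
  moreover have "\<bar>z (j + 1) - z j - c\<bar> \<le> e"
    using step by simp
  ultimately show ?case
    by (simp add: algebra_simps)
qed

lemma telescoping_bound:
  fixes z :: "int \<Rightarrow> real"
  assumes "\<And>l. min i j \<le> l \<Longrightarrow> l < max i j \<Longrightarrow> \<bar>z (l + 1) - z l\<bar> \<le> e"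
  shows "\<bar>z j - z i\<bar> \<le> \<bar>of_int (j - i)\<bar> * e"
proof (cases "i \<le> j")
  case True
  then show ?thesis
    using telescoping_deviation[of i j z 0 e] assms by simp
next
  case False
  then show ?thesis
    using telescoping_deviation[of j i z 0 e] assms by (simp add: abs_minus_commute)
qed

lemma tendsto_floor_scaled:
  assumes "F \<le> sequentially"
  shows "((\<lambda>n. of_int \<lfloor>real n * t\<rfloor> / real n) \<longlongrightarrow> (t::real)) F"
proof -
  have "(\<lambda>n. of_int \<lfloor>real n * t\<rfloor> / real n) \<longlonglongrightarrow> t"
  proof (rule tendsto_sandwich)
    show "\<forall>\<^sub>F n in sequentially. t - 1 / real n \<le> of_int \<lfloor>real n * t\<rfloor> / real n"
      using eventually_gt_at_top[of 0]
    proof eventually_elim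
      case (elim n)
      have "(real n * t - 1) / real n \<le> of_int \<lfloor>real n * t\<rfloor> / real n"
        by (intro divide_right_mono) linarith+
      then show ?case using elim by (simp add: diff_divide_distrib)
    qed
    show "\<forall>\<^sub>F n in sequentially. of_int \<lfloor>real n * t\<rfloor> / real n \<le> t"
      using eventually_gt_at_top[of 0]
    proof eventually_elim
      case (elim n)
      have "of_int \<lfloor>real n * t\<rfloor> \<le> real n * t" by linarith
      then show ?case using elim by (simp add: field_simps)
    qed
    show "(\<lambda>n. t - 1 / real n) \<longlonglongrightarrow> t"
      using tendsto_diff[OF tendsto_const[of t] lim_1_over_n[where 'a=real]] by simp
  qed simp
  then show ?thesis using assms by (rule tendsto_mono[rotated])
qed

text \<open>Near \<open>t0\<close> all difference quotients are within \<open>e\<close> of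
  \<open>c\<close>, uniformly in \<open>n\<close>. Summing them bounds the increment over a short
  interval, and this inequality involves only two values of the function, so it survives pointwise
  convergence.\<close>

lemma lattice_limit_has_derivative:
  fixes z :: "nat \<Rightarrow> int \<Rightarrow> real"
  assumes F: "F \<noteq> bot" "F \<le> sequentially"
    and lim: "\<And>t. ((\<lambda>n. z n \<lfloor>real n * t\<rfloor>) \<longlongrightarrow> \<zeta> t) F"
    and slope: "\<And>e. e > 0 \<Longrightarrow> \<exists>d>0. \<forall>\<^sub>F n in F. \<forall>l. \<bar>of_int l / real n - t0\<bar> \<le> d
                   \<longrightarrow> \<bar>real n * (z n (l + 1) - z n l) - c\<bar> \<le> e"
  shows "(\<zeta> has_real_derivative c) (at t0)"
proof -
  have key: "\<exists>d>0. \<forall>s t. t0 - d \<le> s \<longrightarrow> s \<le> t \<longrightarrow> t \<le> t0 + d \<longrightarrow> \<bar>\<zeta> t - \<zeta> s - (t - s) * c\<bar> \<le> (t - s) * e"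
    if e: "e > 0" for e
  proof -
    obtain d where d: "d > 0" and ev: "\<forall>\<^sub>F n in F. \<forall>l. \<bar>of_int l / real n - t0\<bar> \<le> d
                   \<longrightarrow> \<bar>real n * (z n (l + 1) - z n l) - c\<bar> \<le> e"
      using slope[OF e] by blast
    \<comment> \<open>Half the radius is kept in reserve: rounding down \<open>real n * s\<close>
      moves the time to the left by at most \<open>1 / n\<close>, which is eventually below
      \<open>d / 2\<close>.\<close>
    have "\<bar>\<zeta> t - \<zeta> s - (t - s) * c\<bar> \<le> (t - s) * e"
      if st: "t0 - d/2 \<le> s" "s \<le> t" "t \<le> t0 + d/2" for s t
    proof -
      let ?r = "\<lambda>n t. of_int \<lfloor>real n * t\<rfloor> / real n :: real"
      have large: "\<forall>\<^sub>F n in F. real n > 2 / d"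
        by (rule eventually_real_gt[OF F(2)])
      have pos: "\<forall>\<^sub>F n in F. n > 0"
        by (rule filter_leD[OF F(2)]) (rule eventually_gt_at_top)
      have "\<forall>\<^sub>F n in F. \<bar>z n \<lfloor>real n * t\<rfloor> - z n \<lfloor>real n * s\<rfloor> - (?r n t - ?r n s) * c\<bar>
              \<le> (?r n t - ?r n s) * e"
        using ev large pos
      proof eventually_elim
        case (elim n)
        let ?i = "\<lfloor>real n * s\<rfloor>" and ?j = "\<lfloor>real n * t\<rfloor>"
        have "?i \<le> ?j" using st by (intro floor_mono mult_left_mono) auto
        moreover have "\<bar>z n (l + 1) - z n l - c / real n\<bar> \<le> e / real n" if "?i \<le> l" "l < ?j" for l
        proof -
          have "real n * s - 1 \<le> of_int l" using that by linarith
          then have "(real n * s - 1) / real n \<le> of_int l / real n"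
            by (rule divide_right_mono) simp
          then have "s - 1 / real n \<le> of_int l / real n"
            using elim(3) by (simp add: diff_divide_distrib)
          moreover have "of_int l \<le> real n * t" using that by linarith
          then have "of_int l / real n \<le> t"
            using elim(3) by (simp add: divide_le_eq mult.commute)
          moreover have "1 / real n < d / 2" using elim d by (simp add: field_simps)
          ultimately have "\<bar>of_int l / real n - t0\<bar> \<le> d" using st by argo
          then have "\<bar>real n * (z n (l + 1) - z n l) - c\<bar> \<le> e" using elim(1) by blast
          moreover have "z n (l + 1) - z n l - c / real n = (real n * (z n (l + 1) - z n l) - c) / real n"
            using elim(3) by (simp add: field_simps)
          ultimately show ?thesis by (simp add: divide_right_mono abs_divide)
        qed
        ultimately show ?case
          using telescoping_deviation[of ?i ?j "z n" "c / real n" "e / real n"]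
          by (simp add: diff_divide_distrib[symmetric])
      qed
      moreover have "((\<lambda>n. \<bar>z n \<lfloor>real n * t\<rfloor> - z n \<lfloor>real n * s\<rfloor> - (?r n t - ?r n s) * c\<bar>)
             \<longlongrightarrow> \<bar>\<zeta> t - \<zeta> s - (t - s) * c\<bar>) F"
        by (intro tendsto_intros lim tendsto_floor_scaled F)
      moreover have "((\<lambda>n. (?r n t - ?r n s) * e) \<longlongrightarrow> (t - s) * e) F"
        by (intro tendsto_intros tendsto_floor_scaled F)
      ultimately show ?thesis
        using tendsto_le[OF F(1)] by blast
    qed
    then show ?thesis using d by (intro exI[of _ "d/2"]) auto
  qed
  show ?thesis
    unfolding has_field_derivative_def has_derivative_at_alt
  proof (intro conjI allI impI)
    fix e :: real assume "e > 0"
    from key[OF this] obtain d where d: "d > 0"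
      and dev: "\<And>s t. t0 - d \<le> s \<Longrightarrow> s \<le> t \<Longrightarrow> t \<le> t0 + d
                  \<Longrightarrow> \<bar>\<zeta> t - \<zeta> s - (t - s) * c\<bar> \<le> (t - s) * e"
      by blast
    have "norm (\<zeta> y - \<zeta> t0 - c * (y - t0)) \<le> e * norm (y - t0)" if "norm (y - t0) < d" for y
    proof (cases "t0 \<le> y")
      case True
      then show ?thesis using dev[of t0 y] that by (simp add: mult.commute)
    next
      case False
      then have "\<bar>\<zeta> t0 - \<zeta> y - (t0 - y) * c\<bar> \<le> (t0 - y) * e"
        using dev[of y t0] that by simp
      moreover have "\<zeta> y - \<zeta> t0 - c * (y - t0) = - (\<zeta> t0 - \<zeta> y - (t0 - y) * c)"
        by (simp add: algebra_simps)
      ultimately show ?thesis using False by (simp add: mult.commute)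
    qed
    then show "\<exists>d>0. \<forall>y. norm (y - t0) < d \<longrightarrow> norm (\<zeta> y - \<zeta> t0 - c * (y - t0)) \<le> e * norm (y - t0)"
      using d by blast
  qed (rule bounded_linear_mult_right)
qed

text \<open>Compactness is used through filters: a cluster point in the product space gives convergence at
  all real times simultaneously, so that no diagonal subsequence is needed.\<close>

lemma pointwise_cluster_filter:
  fixes u :: "nat \<Rightarrow> 'a \<Rightarrow> 'b::heine_borel"
  assumes "\<And>t. bounded (range (\<lambda>n. u n t))"
  obtains F g where "F \<noteq> bot" "F \<le> sequentially" "\<And>t. ((\<lambda>n. u n t) \<longlongrightarrow> g t) F"
proof -
  \<comment> \<open>Each factor is compact by Heine-Borel, hence the product is compact by
    Tychonoff.\<close>
  let ?K = "PiE UNIV (\<lambda>t. closure (range (\<lambda>n. u n t)))"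
  have "compactin (product_topology (\<lambda>_. euclidean) UNIV) ?K"
    unfolding compactin_PiE using assms by (simp add: compact_closure)
  then have "compact ?K" by (simp add: euclidean_product_topology)
  moreover have "eventually (\<lambda>f. f \<in> ?K) (filtermap u sequentially)"
    by (simp add: eventually_filtermap PiE_UNIV_domain closure_subset[THEN subsetD])
  moreover have "filtermap u sequentially \<noteq> bot"
    by (simp add: filtermap_bot_iff)
  ultimately obtain g where g: "inf (nhds g) (filtermap u sequentially) \<noteq> bot"
    unfolding compact_filter by blast
  \<comment> \<open>The neighbourhoods of \<open>g\<close> are pulled back to the indices. Along
    \<open>F\<close> the functions converge to \<open>g\<close>, and \<open>F\<close> is proper
    because \<open>g\<close> is a cluster point.\<close>
  define F where "F = inf (filtercomap u (nhds g)) sequentially"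
  have "F \<noteq> bot"
  proof
    assume "F = bot"
    then have "eventually (\<lambda>_. False) F" by simp
    then obtain P Q where "eventually P (filtercomap u (nhds g))" "eventually Q sequentially"
      and PQ: "\<And>n. P n \<Longrightarrow> Q n \<Longrightarrow> False"
      unfolding F_def eventually_inf by auto
    then obtain P' where "eventually P' (nhds g)" "\<And>n. P' (u n) \<Longrightarrow> P n"
      unfolding eventually_filtercomap by auto
    moreover have "eventually (\<lambda>f. \<not> P' f) (filtermap u sequentially)"
      unfolding eventually_filtermap using \<open>eventually Q sequentially\<close>
      by eventually_elim (use PQ calculation(2) in blast)
    ultimately have "eventually (\<lambda>_. False) (inf (nhds g) (filtermap u sequentially))"
      unfolding eventually_inf by blast
    then show False using g by (simp add: trivial_limit_def)
  qed
  moreover have "F \<le> sequentially" by (simp add: F_def)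
  moreover have "((\<lambda>n. u n t) \<longlongrightarrow> g t) F" for t
  proof -
    have "filterlim u (nhds g) F"
      unfolding F_def filterlim_def using filtermap_filtercomap[of u "nhds g"]
      by (meson filtermap_mono inf_le1 order_trans)
    then show ?thesis
      by (rule continuous_on_tendsto_compose[OF continuous_on_product_coordinates, of _ _ _ t, simplified])
  qed
  ultimately show thesis using that by blast
qed

text \<open>Equicontinuity turns convergence at the single time \<open>t0\<close> into uniform
  closeness on a neighbourhood: half of \<open>e\<close> pays for the convergence at
  \<open>t0\<close>, half for the drift away from it.\<close>

lemma lattice_limit_near:
  fixes z :: "nat \<Rightarrow> int \<Rightarrow> real"
  assumes F: "F \<le> sequentially"
    and lim: "((\<lambda>n. z n \<lfloor>real n * t0\<rfloor>) \<longlongrightarrow> \<zeta>) F"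
    and lip: "\<And>R. \<exists>L. \<forall>\<^sub>F n in F. \<forall>l. \<bar>of_int l\<bar> \<le> R * real n \<longrightarrow> \<bar>z n (l + 1) - z n l\<bar> \<le> L / real n"
    and e: "e > 0"
  shows "\<exists>d>0. \<forall>\<^sub>F n in F. \<forall>l. \<bar>of_int l / real n - t0\<bar> \<le> d \<longrightarrow> \<bar>z n l - \<zeta>\<bar> \<le> e"
proof -
  obtain L where "\<forall>\<^sub>F n in F. \<forall>l. \<bar>of_int l\<bar> \<le> (\<bar>t0\<bar> + 1) * real n \<longrightarrow> \<bar>z n (l + 1) - z n l\<bar> \<le> L / real n"
    using lip by blast
  then have ev: "\<forall>\<^sub>F n in F. \<forall>l. \<bar>of_int l\<bar> \<le> (\<bar>t0\<bar> + 1) * real n \<longrightarrow> \<bar>z n (l + 1) - z n l\<bar> \<le> \<bar>L\<bar> / real n"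
    by eventually_elim (meson abs_ge_self divide_right_mono of_nat_0_le_iff order_trans)
  \<comment> \<open>The bound \<open>1/2\<close> keeps all indices in the range of the Lipschitz
    estimate. The other bound makes a drift over time \<open>2 * d\<close> cost at most
    \<open>e / 2\<close>; the factor 2 absorbs the rounding of \<open>real n * t0\<close>, since
    \<open>1 \<le> d * real n\<close>.\<close>
  define d where "d = min (1/2) (e / (4 * (\<bar>L\<bar> + 1)))"
  have d: "d > 0" "d \<le> 1/2" "\<bar>L\<bar> * (2 * d) \<le> e / 2"
  proof -
    show "d > 0" using e by (auto simp: d_def)
    show "d \<le> 1/2" unfolding d_def by (rule min.cobounded1)
    have "\<bar>L\<bar> * (2 * d) \<le> (\<bar>L\<bar> + 1) * (2 * (e / (4 * (\<bar>L\<bar> + 1))))"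
      using e by (intro mult_mono) (auto simp: d_def)
    also have "\<dots> = e / 2" by (simp add: field_simps add_nonneg_eq_0_iff)
    finally show "\<bar>L\<bar> * (2 * d) \<le> e / 2" .
  qed
  have near: "\<forall>\<^sub>F n in F. \<bar>z n \<lfloor>real n * t0\<rfloor> - \<zeta>\<bar> < e / 2"
    using tendstoD[OF lim, of "e/2"] e by (simp add: dist_real_def)
  have large: "\<forall>\<^sub>F n in F. real n > 1 / d"
    by (rule eventually_real_gt[OF F])
  have pos: "\<forall>\<^sub>F n in F. n > 0"
    by (rule filter_leD[OF F]) (rule eventually_gt_at_top)
  have "\<forall>\<^sub>F n in F. \<forall>l. \<bar>of_int l / real n - t0\<bar> \<le> d \<longrightarrow> \<bar>z n l - \<zeta>\<bar> \<le> e"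
    using ev near large pos
  proof eventually_elim
    case (elim n)
    show ?case
    proof (intro allI impI)
      fix l :: int assume l: "\<bar>of_int l / real n - t0\<bar> \<le> d"
      let ?i = "\<lfloor>real n * t0\<rfloor>"
      have n: "1 \<le> d * real n" using elim d by (simp add: field_simps)
      have "\<bar>of_int l - real n * t0\<bar> = real n * \<bar>of_int l / real n - t0\<bar>"
        using elim(4) by (simp flip: abs_mult[of "real n", simplified] add: right_diff_distrib)
      also have "\<dots> \<le> real n * d" using l by (intro mult_left_mono) auto
      finally have ln: "\<bar>of_int l - real n * t0\<bar> \<le> d * real n" by (simp add: mult.commute)
      have dn: "d * real n \<le> real n / 2" using mult_right_mono[OF d(2), of "real n"] by simp
      have t0n: "\<bar>real n * t0\<bar> = \<bar>t0\<bar> * real n" by (simp add: abs_mult)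
      have "\<bar>z n l - z n ?i\<bar> \<le> \<bar>of_int (l - ?i)\<bar> * (\<bar>L\<bar> / real n)"
      proof (rule telescoping_bound)
        fix k assume "min ?i l \<le> k" "k < max ?i l"
        then have "\<bar>of_int k\<bar> \<le> \<bar>t0\<bar> * real n + 2 * (d * real n)" using ln n t0n by linarith
        also have "\<dots> \<le> (\<bar>t0\<bar> + 1) * real n" using dn by (simp add: algebra_simps)
        finally show "\<bar>z n (k + 1) - z n k\<bar> \<le> \<bar>L\<bar> / real n" using elim(1) by blast
      qed
      also have "\<dots> \<le> (2 * (d * real n)) * (\<bar>L\<bar> / real n)"
      proof (rule mult_right_mono)
        show "\<bar>of_int (l - ?i)\<bar> \<le> 2 * (d * real n)" using ln n by linarith
      qed simp
      also have "\<dots> = \<bar>L\<bar> * (2 * d)" using elim(4) by simp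
      finally show "\<bar>z n l - \<zeta>\<bar> \<le> e" using d(3) elim(2) by linarith
    qed
  qed
  then show ?thesis using d by blast
qed

section \<open>Convergence of bounded solutions of the discrete equation\<close>

lemma continuous_bounded_symmetric_interval:
  fixes f :: "real \<Rightarrow> real"
  assumes "continuous_on UNIV f"
  obtains B where "\<And>t. \<bar>t\<bar> \<le> r \<Longrightarrow> \<bar>f t\<bar> \<le> B"
  using compact_imp_bounded[OF compact_continuous_image[OF continuous_on_subset[OF assms] compact_Icc[of "-r" r]]]
  by (fastforce simp: bounded_iff)

lemma continuous_product_bounded:
  fixes b q :: "real \<Rightarrow> real"
  assumes "continuous_on UNIV b" "continuous_on UNIV q"
  obtains K where "K \<ge> 0" "\<And>t y. \<bar>t\<bar> \<le> R \<Longrightarrow> \<bar>y\<bar> \<le> r \<Longrightarrow> \<bar>b t * q y\<bar> \<le> K"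
proof -
  obtain B where B: "\<And>t. \<bar>t\<bar> \<le> R \<Longrightarrow> \<bar>b t\<bar> \<le> B"
    using continuous_bounded_symmetric_interval[OF assms(1)] by blast
  obtain Q where Q: "\<And>y. \<bar>y\<bar> \<le> r \<Longrightarrow> \<bar>q y\<bar> \<le> Q"
    using continuous_bounded_symmetric_interval[OF assms(2)] by blast
  have "\<bar>b t * q y\<bar> \<le> \<bar>B\<bar> * \<bar>Q\<bar>" if "\<bar>t\<bar> \<le> R" "\<bar>y\<bar> \<le> r" for t y
    unfolding abs_mult using B[OF that(1)] Q[OF that(2)] by (intro mult_mono) auto
  then show thesis by (intro that[of "\<bar>B\<bar> * \<bar>Q\<bar>"]) auto
qed

text \<open>A discrete Arzela-Ascoli argument for the first-order system in \<open>(X, v)\<close>.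
  The equation makes \<open>v\<close> Lipschitz, boundedness of \<open>X\<close> then bounds
  \<open>v\<close>, and so \<open>X\<close> is Lipschitz too, all locally uniformly in
  \<open>n\<close>. The difference quotients of \<open>X\<close> and of \<open>v\<close> then
  converge locally uniformly along the filter.\<close>

lemma lattice_solutions_accumulate:
  fixes X v :: "nat \<Rightarrow> int \<Rightarrow> real" and b q :: "real \<Rightarrow> real"
  assumes b: "continuous_on UNIV b" and q: "continuous_on UNIV q"
    and X: "\<And>n k. \<bar>X n k\<bar> \<le> 1"
    and v: "\<And>n k. v n k = real n * (X n (k + 1) - X n k)"
    and eq: "\<And>R. \<forall>\<^sub>F n in sequentially. \<forall>k. \<bar>of_int k\<bar> \<le> R * real n
               \<longrightarrow> real n * (v n (k + 1) - v n k) = b (of_int (k + 1) / real n) * q (X n (k + 1))"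
  obtains F x w where "F \<noteq> bot" "F \<le> sequentially"
    "\<And>t. ((\<lambda>n. X n \<lfloor>real n * t\<rfloor>) \<longlongrightarrow> x t) F"
    "\<And>t. (x has_real_derivative w t) (at t)"
    "\<And>t. (w has_real_derivative b t * q (x t)) (at t)"
proof -
  have pos: "\<forall>\<^sub>F n::nat in sequentially. n > 0" by (rule eventually_gt_at_top)
  \<comment> \<open>The equation at \<open>k\<close> evaluates its right-hand side at site
    \<open>k + 1\<close>, so \<open>b\<close> is bounded on the larger interval of radius
    \<open>R + 1\<close>.\<close>
  have v_lip: "\<exists>L\<ge>0. \<forall>\<^sub>F n in sequentially. \<forall>l. \<bar>of_int l\<bar> \<le> R * real n \<longrightarrow> \<bar>v n (l + 1) - v n l\<bar> \<le> L / real n" for R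
  proof -
    obtain K where K: "K \<ge> 0" "\<And>t y. \<bar>t\<bar> \<le> R + 1 \<Longrightarrow> \<bar>y\<bar> \<le> 1 \<Longrightarrow> \<bar>b t * q y\<bar> \<le> K"
      using continuous_product_bounded[OF b q] by blast
    have "\<forall>\<^sub>F n in sequentially. \<forall>l. \<bar>of_int l\<bar> \<le> R * real n \<longrightarrow> \<bar>v n (l + 1) - v n l\<bar> \<le> K / real n"
      using eq[of R] pos
    proof eventually_elim
      case (elim n)
      show ?case
      proof (intro allI impI)
        fix l :: int assume l: "\<bar>of_int l\<bar> \<le> R * real n"
        have "\<bar>of_int (l + 1)\<bar> \<le> (R + 1) * real n"
          using l elim(2) by (simp add: algebra_simps)
        then have "\<bar>of_int (l + 1) / real n\<bar> \<le> R + 1"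
          using elim(2) by (simp add: abs_divide divide_le_eq)
        then have "\<bar>real n * (v n (l + 1) - v n l)\<bar> \<le> K"
          using elim(1) l K(2) X by metis
        then show "\<bar>v n (l + 1) - v n l\<bar> \<le> K / real n"
          using elim(2) by (simp add: abs_mult pos_le_divide_eq mult.commute)
      qed
    qed
    then show ?thesis using K(1) by blast
  qed
  \<comment> \<open>During one unit of time, that is \<open>n\<close> steps, \<open>v\<close>
    changes by at most \<open>L\<close>, so the displacement of \<open>X\<close> differs from
    \<open>v n k\<close> by at most \<open>L\<close>. The displacement itself is at most 2.\<close>
  have v_bound: "\<exists>L. \<forall>\<^sub>F n in sequentially. \<forall>l. \<bar>of_int l\<bar> \<le> R * real n \<longrightarrow> \<bar>v n l\<bar> \<le> L" for R
  proof -
    obtain L where L: "L \<ge> 0" and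
      ev: "\<forall>\<^sub>F n in sequentially. \<forall>l. \<bar>of_int l\<bar> \<le> (R + 1) * real n \<longrightarrow> \<bar>v n (l + 1) - v n l\<bar> \<le> L / real n"
      using v_lip by blast
    have "\<forall>\<^sub>F n in sequentially. \<forall>l. \<bar>of_int l\<bar> \<le> R * real n \<longrightarrow> \<bar>v n l\<bar> \<le> L + 2"
      using ev pos
    proof eventually_elim
      case (elim n)
      show ?case
      proof (intro allI impI)
        fix k :: int assume k: "\<bar>of_int k\<bar> \<le> R * real n"
        have close: "\<bar>v n l - v n k\<bar> \<le> L" if "k \<le> l" "l < k + int n" for l
        proof -
          have "\<bar>v n l - v n k\<bar> \<le> \<bar>of_int (l - k)\<bar> * (L / real n)"
          proof (rule telescoping_bound)
            fix i assume "min k l \<le> i" "i < max k l"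
            then have "\<bar>of_int i\<bar> \<le> (R + 1) * real n"
              using k that by (simp add: algebra_simps)
            then show "\<bar>v n (i + 1) - v n i\<bar> \<le> L / real n" using elim by blast
          qed
          also have "\<dots> \<le> real n * (L / real n)"
            using that elim L by (intro mult_right_mono) auto
          finally show ?thesis using elim by simp
        qed
        have "\<bar>X n (k + int n) - X n k - of_int (k + int n - k) * (v n k / real n)\<bar>
                 \<le> of_int (k + int n - k) * (L / real n)"
        proof (rule telescoping_deviation)
          fix l assume "k \<le> l" "l < k + int n"
          from close[OF this] have "\<bar>v n l - v n k\<bar> / real n \<le> L / real n"
            by (simp add: divide_right_mono)
          moreover have "X n (l + 1) - X n l - v n k / real n = (v n l - v n k) / real n"
            using elim by (simp add: v[of n l] field_simps)
          ultimately show "\<bar>X n (l + 1) - X n l - v n k / real n\<bar> \<le> L / real n"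
            by (simp add: abs_divide)
        qed simp
        then have "\<bar>X n (k + int n) - X n k - v n k\<bar> \<le> L" using elim by simp
        then show "\<bar>v n k\<bar> \<le> L + 2" using X[of n k] X[of n "k + int n"] by linarith
      qed
    qed
    then show ?thesis by blast
  qed
  have X_lip: "\<exists>L. \<forall>\<^sub>F n in sequentially. \<forall>l. \<bar>of_int l\<bar> \<le> R * real n \<longrightarrow> \<bar>X n (l + 1) - X n l\<bar> \<le> L / real n" for R
  proof -
    obtain L where "\<forall>\<^sub>F n in sequentially. \<forall>l. \<bar>of_int l\<bar> \<le> R * real n \<longrightarrow> \<bar>v n l\<bar> \<le> L"
      using v_bound by blast
    then have "\<forall>\<^sub>F n in sequentially. \<forall>l. \<bar>of_int l\<bar> \<le> R * real n \<longrightarrow> \<bar>X n (l + 1) - X n l\<bar> \<le> L / real n"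
      using pos by eventually_elim (simp add: v abs_mult pos_le_divide_eq mult.commute)
    then show ?thesis by blast
  qed
  \<comment> \<open>Positions and velocities are treated as one pair so that a single filter makes
    both converge.\<close>
  have "bounded (range (\<lambda>n. (X n \<lfloor>real n * t\<rfloor>, v n \<lfloor>real n * t\<rfloor>)))" for t
  proof -
    obtain L where "\<forall>\<^sub>F n in sequentially. \<forall>l. \<bar>of_int l\<bar> \<le> (\<bar>t\<bar> + 1) * real n \<longrightarrow> \<bar>v n l\<bar> \<le> L"
      using v_bound by blast
    then have "\<forall>\<^sub>F n in sequentially. norm (v n \<lfloor>real n * t\<rfloor>) \<le> L"
      using pos
    proof eventually_elim
      case (elim n)
      have "\<bar>of_int \<lfloor>real n * t\<rfloor>\<bar> \<le> \<bar>real n * t\<bar> + 1" by linarith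
      also have "\<dots> \<le> (\<bar>t\<bar> + 1) * real n" using elim by (simp add: abs_mult algebra_simps)
      finally show ?case using elim by simp
    qed
    then have "Bseq (\<lambda>n. v n \<lfloor>real n * t\<rfloor>)" by (rule BfunI)
    then have "bounded (range (\<lambda>n. v n \<lfloor>real n * t\<rfloor>))" by (simp add: Bseq_eq_bounded)
    moreover have "bounded (range (\<lambda>n. X n \<lfloor>real n * t\<rfloor>))"
      using X by (auto simp: bounded_iff)
    ultimately have "bounded (range (\<lambda>n. X n \<lfloor>real n * t\<rfloor>) \<times> range (\<lambda>n. v n \<lfloor>real n * t\<rfloor>))"
      by (simp add: bounded_Times)
    then show ?thesis by (rule bounded_subset) auto
  qed
  then obtain F g where F: "F \<noteq> bot" "F \<le> sequentially"
    and g: "\<And>t. ((\<lambda>n. (X n \<lfloor>real n * t\<rfloor>, v n \<lfloor>real n * t\<rfloor>)) \<longlongrightarrow> g t) F"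
    using pointwise_cluster_filter[of "\<lambda>n t. (X n \<lfloor>real n * t\<rfloor>, v n \<lfloor>real n * t\<rfloor>)"] by blast
  define x where "x t = fst (g t)" for t
  define w where "w t = snd (g t)" for t
  have x_lim: "((\<lambda>n. X n \<lfloor>real n * t\<rfloor>) \<longlongrightarrow> x t) F" for t
    using tendsto_fst[OF g] by (simp add: x_def)
  have w_lim: "((\<lambda>n. v n \<lfloor>real n * t\<rfloor>) \<longlongrightarrow> w t) F" for t
    using tendsto_snd[OF g] by (simp add: w_def)
  have X_near: "\<exists>d>0. \<forall>\<^sub>F n in F. \<forall>l. \<bar>of_int l / real n - t\<bar> \<le> d \<longrightarrow> \<bar>X n l - x t\<bar> \<le> e" if "e > 0" for e t
  proof (rule lattice_limit_near[where z=X, OF F(2) x_lim _ that])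
    show "\<exists>L. \<forall>\<^sub>F n in F. \<forall>l. \<bar>of_int l\<bar> \<le> R * real n \<longrightarrow> \<bar>X n (l + 1) - X n l\<bar> \<le> L / real n" for R
      using X_lip[of R] by (auto intro: filter_leD[OF F(2)])
  qed
  have v_near: "\<exists>d>0. \<forall>\<^sub>F n in F. \<forall>l. \<bar>of_int l / real n - t\<bar> \<le> d \<longrightarrow> \<bar>v n l - w t\<bar> \<le> e" if "e > 0" for e t
  proof (rule lattice_limit_near[where z=v, OF F(2) w_lim _ that])
    show "\<exists>L. \<forall>\<^sub>F n in F. \<forall>l. \<bar>of_int l\<bar> \<le> R * real n \<longrightarrow> \<bar>v n (l + 1) - v n l\<bar> \<le> L / real n" for R
      using v_lip[of R] by (auto intro: filter_leD[OF F(2)])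
  qed
  have "(x has_real_derivative w t) (at t)" for t
    using lattice_limit_has_derivative[OF F, of X x t "w t"] x_lim v_near by (simp add: v)
  moreover have "(w has_real_derivative b t * q (x t)) (at t)" for t
  proof (rule lattice_limit_has_derivative[OF F, of v w, OF w_lim])
    fix e :: real assume e: "e > 0"
    obtain d where d: "d > 0" and bq: "\<And>s y. \<bar>s - t\<bar> \<le> d \<Longrightarrow> \<bar>y - x t\<bar> \<le> d \<Longrightarrow> \<bar>b s * q y - b t * q (x t)\<bar> \<le> e"
    proof -
      have "continuous_on UNIV (\<lambda>p. b (fst p) * q (snd p))"
        by (intro continuous_intros continuous_on_compose2[OF b] continuous_on_compose2[OF q]) auto
      then obtain d where d: "d > 0" and
        near: "\<And>p. dist p (t, x t) < d \<Longrightarrow> dist (b (fst p) * q (snd p)) (b t * q (x t)) < e"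
        unfolding continuous_on_iff using e by (metis UNIV_I fst_conv snd_conv)
      \<comment> \<open>Two coordinate errors of \<open>d/3\<close> add up to less than
        \<open>d\<close>, and their sum dominates the product metric.\<close>
      have "\<bar>b s * q y - b t * q (x t)\<bar> \<le> e" if "\<bar>s - t\<bar> \<le> d/3" "\<bar>y - x t\<bar> \<le> d/3" for s y
      proof -
        have "dist (s, y) (t, x t) \<le> \<bar>s - t\<bar> + \<bar>y - x t\<bar>"
          using sqrt_sum_squares_le_sum_abs[of "s - t" "y - x t"] by (simp add: dist_Pair_Pair dist_real_def)
        then show ?thesis using near[of "(s, y)"] that d by (simp add: dist_real_def)
      qed
      then show thesis using that[of "d/3"] d by simp
    qed
    obtain d' where d': "d' > 0" and ev: "\<forall>\<^sub>F n in F. \<forall>l. \<bar>of_int l / real n - t\<bar> \<le> d' \<longrightarrow> \<bar>X n l - x t\<bar> \<le> d"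
      using X_near[OF d] by blast
    \<comment> \<open>Moving from site \<open>l\<close> to \<open>l + 1\<close> adds
      \<open>1 / n \<le> r\<close> to the time error, so both radii must accommodate
      \<open>2 * r\<close>.\<close>
    define r where "r = min d d' / 2"
    have r: "r > 0" "2 * r \<le> d" "2 * r \<le> d'" using d d' by (auto simp: r_def)
    have "\<forall>\<^sub>F n in F. real n > 1 / r" by (rule eventually_real_gt[OF F(2)])
    moreover note ev filter_leD[OF F(2) pos] filter_leD[OF F(2) eq[of "\<bar>t\<bar> + r"]]
    ultimately have "\<forall>\<^sub>F n in F. \<forall>l. \<bar>of_int l / real n - t\<bar> \<le> r \<longrightarrow> \<bar>real n * (v n (l + 1) - v n l) - b t * q (x t)\<bar> \<le> e"
    proof eventually_elim
      case (elim n)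
      show ?case
      proof (intro allI impI)
        fix l :: int assume l: "\<bar>of_int l / real n - t\<bar> \<le> r"
        have "1 / real n \<le> r" using elim r by (simp add: field_simps)
        moreover have "of_int (l + 1) / real n = of_int l / real n + 1 / real n"
          by (simp add: add_divide_distrib)
        moreover have "1 / real n \<ge> 0" by simp
        ultimately have *: "\<bar>of_int (l + 1) / real n - t\<bar> \<le> 2 * r" using l by linarith
        have "\<bar>of_int l / real n\<bar> \<le> \<bar>t\<bar> + r" using l by linarith
        then have "\<bar>of_int l\<bar> \<le> (\<bar>t\<bar> + r) * real n"
          using elim(3) by (simp add: abs_divide divide_le_eq)
        then have "real n * (v n (l + 1) - v n l) = b (of_int (l + 1) / real n) * q (X n (l + 1))"
          using elim(4) by blast
        moreover have "\<bar>X n (l + 1) - x t\<bar> \<le> d" using elim(2) * r by force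
        ultimately show "\<bar>real n * (v n (l + 1) - v n l) - b t * q (x t)\<bar> \<le> e"
          using bq[of "of_int (l + 1) / real n" "X n (l + 1)"] * r by simp
      qed
    qed
    then show "\<exists>d>0. \<forall>\<^sub>F n in F. \<forall>l. \<bar>of_int l / real n - t\<bar> \<le> d \<longrightarrow> \<bar>real n * (v n (l + 1) - v n l) - b t * q (x t)\<bar> \<le> e"
      using r by blast
  qed
  ultimately show thesis using that[OF F x_lim] by blast
qed

subsection \<open>The discrete action\<close>

text \<open>The action of one cell of length \<open>1 / n\<close>. The potential is sampled at the
  left end only, so the value at site \<open>k\<close> enters just the cells \<open>k - 1\<close>
  and \<open>k\<close>, and its potential just the latter.\<close>

definition lattice_energy :: "(real \<Rightarrow> real) \<Rightarrow> (real \<Rightarrow> real) \<Rightarrow> nat \<Rightarrow> (int \<Rightarrow> real) \<Rightarrow> int \<Rightarrow> real" where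
  "lattice_energy b V n X l = real n * (X (l + 1) - X l)\<^sup>2 / 2 + b (of_int l / real n) * V (X l) / real n"

section \<open>The cost of crossing a range of values\<close>

text \<open>A shortest crossing works: an inner site with value outside
  \<open>(\<alpha>, \<beta>)\<close> could replace one of its ends.\<close>

lemma crossing_segment:
  fixes X :: "int \<Rightarrow> real"
  assumes "i0 \<le> j0" "X i0 \<le> \<alpha>" "\<beta> \<le> X j0" "\<alpha> < \<beta>"
  obtains i j where "i0 \<le> i" "i < j" "j \<le> j0" "X i \<le> \<alpha>" "\<beta> \<le> X j"
    "\<And>l. i < l \<Longrightarrow> l < j \<Longrightarrow> \<alpha> < X l \<and> X l < \<beta>"
proof -
  define P where "P p \<longleftrightarrow> i0 \<le> fst p \<and> fst p \<le> snd p \<and> snd p \<le> j0 \<and> X (fst p) \<le> \<alpha> \<and> \<beta> \<le> X (snd p)"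
    for p
  have "P (i0, j0)" using assms by (simp add: P_def)
  then obtain p where p: "P p" and min: "\<And>p'. P p' \<Longrightarrow> nat (snd p - fst p) \<le> nat (snd p' - fst p')"
    using ex_has_least_nat[of P "(i0, j0)" "\<lambda>p. nat (snd p - fst p)"] by blast
  obtain i j where ij: "p = (i, j)" by force
  have "i \<noteq> j" using p assms(4) by (auto simp: P_def ij)
  moreover have "\<alpha> < X l \<and> X l < \<beta>" if "i < l" "l < j" for l
    using min[of "(l, j)"] min[of "(i, l)"] p that by (auto simp: P_def ij not_le[symmetric])
  ultimately show thesis using that[of i j] p by (auto simp: P_def ij)
qed

text \<open>The Cauchy-Schwarz inequality for the increments.\<close>

lemma telescoping_square:
  fixes X :: "int \<Rightarrow> real"
  assumes "i \<le> j"
  shows "(X j - X i)\<^sup>2 \<le> (\<Sum>l\<in>{i..<j}. (X (l + 1) - X l)\<^sup>2) * of_int (j - i)"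
proof -
  have "(\<Sum>l\<in>{i..<j}. X (l + 1) - X l) = X j - X i"
    using assms
  proof (induction j rule: int_ge_induct)
    case (step j)
    then have "{i..<j + 1} = insert j {i..<j}" by auto
    then show ?case using step by simp
  qed simp
  then show ?thesis
    using sum_squared_le_sum_of_squares[of "\<lambda>l. X (l + 1) - X l" "{i..<j}"] assms by simp
qed

lemma lattice_energy_nonneg:
  assumes "\<And>t. b t \<ge> 0" "\<And>y. V y \<ge> 0"
  shows "lattice_energy b V n X l \<ge> 0"
  using assms by (simp add: lattice_energy_def)

text \<open>For a shortest crossing, the kinetic energy bounds its duration from below and the
  potential energy bounds it from above; multiplying the two estimates eliminates the duration. The
  potential sees only the \<open>j - i - 1\<close> inner sites, and the missing step produces the
  correction \<open>2 * C / real n\<close>.\<close>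

lemma crossing_cost:
  fixes X :: "int \<Rightarrow> real"
  assumes n: "n > 0" and "i0 \<le> j0" "X i0 \<le> \<alpha>" "\<beta> \<le> X j0" "\<alpha> < \<beta>"
    and b: "\<And>t. b t \<ge> 0" and V: "\<And>y. V y \<ge> 0"
    and M: "\<And>l. i0 \<le> l \<Longrightarrow> l \<le> j0 \<Longrightarrow> M \<le> b (of_int l / real n)" "M \<ge> 0"
    and m: "\<And>y. \<alpha> \<le> y \<Longrightarrow> y \<le> \<beta> \<Longrightarrow> m \<le> V y" "m \<ge> 0"
    and C: "(\<Sum>l\<in>{i0..<j0}. lattice_energy b V n X l) \<le> C"
  shows "M * m * ((\<beta> - \<alpha>)\<^sup>2 - 2 * C / real n) \<le> 2 * C\<^sup>2"
proof -
  obtain i j where ij: "i0 \<le> i" "i < j" "j \<le> j0" "X i \<le> \<alpha>" "\<beta> \<le> X j"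
    and between: "\<And>l. i < l \<Longrightarrow> l < j \<Longrightarrow> \<alpha> < X l \<and> X l < \<beta>"
    using crossing_segment[of i0 j0 X \<alpha> \<beta>] assms(2-5) by blast
  let ?E = "lattice_energy b V n X"
  have E: "?E l \<ge> 0" for l using b V by (rule lattice_energy_nonneg)
  have EC: "(\<Sum>l\<in>{i..<j}. ?E l) \<le> C"
    using C sum_mono2[of "{i0..<j0}" "{i..<j}" ?E] E ij by force
  have "C \<ge> 0" using EC sum_nonneg[of "{i..<j}" ?E] E by force
  have "(\<beta> - \<alpha>)\<^sup>2 \<le> (X j - X i)\<^sup>2"
    using ij assms(5) by (intro power_mono) auto
  also have "\<dots> \<le> (\<Sum>l\<in>{i..<j}. (X (l + 1) - X l)\<^sup>2) * of_int (j - i)"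
    using telescoping_square ij by simp
  also have "\<dots> \<le> (2 * C / real n) * of_int (j - i)"
  proof (rule mult_right_mono)
    have "real n / 2 * (\<Sum>l\<in>{i..<j}. (X (l + 1) - X l)\<^sup>2) \<le> (\<Sum>l\<in>{i..<j}. ?E l)"
      unfolding sum_distrib_left lattice_energy_def using b V by (intro sum_mono) simp
    then have "real n / 2 * (\<Sum>l\<in>{i..<j}. (X (l + 1) - X l)\<^sup>2) \<le> C" using EC by linarith
    then show "(\<Sum>l\<in>{i..<j}. (X (l + 1) - X l)\<^sup>2) \<le> 2 * C / real n"
      using n by (simp add: pos_le_divide_eq mult.commute)
  qed (use ij in simp)
  finally have kinetic: "(\<beta> - \<alpha>)\<^sup>2 - 2 * C / real n \<le> (2 * C / real n) * of_int (j - i - 1)"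
  proof -
    have "of_int (j - i) = of_int (j - i - 1) + (1 :: real)" by simp
    then show "(\<beta> - \<alpha>)\<^sup>2 \<le> (2 * C / real n) * of_int (j - i) \<Longrightarrow> ?thesis"
      by (simp only: distrib_left)
  qed
  \<comment> \<open>The cell of \<open>i\<close> is left out because \<open>X i\<close> may lie
    below \<alpha>, where \<open>m\<close> is no lower bound for \<open>V\<close>.\<close>
  have "of_int (j - i - 1) * (M * m / real n) = (\<Sum>l\<in>{i+1..<j}. M * m / real n)"
    using ij by simp
  also have "\<dots> \<le> (\<Sum>l\<in>{i+1..<j}. ?E l)"
  proof (rule sum_mono)
    fix l assume l: "l \<in> {i+1..<j}"
    then have "M * m \<le> b (of_int l / real n) * V (X l)"
      using ij M m between[of l] b by (intro mult_mono) auto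
    then have "M * m / real n \<le> b (of_int l / real n) * V (X l) / real n"
      by (rule divide_right_mono) simp
    moreover have "0 \<le> real n * (X (l + 1) - X l)\<^sup>2 / 2" by simp
    ultimately show "M * m / real n \<le> ?E l" unfolding lattice_energy_def by linarith
  qed
  also have "\<dots> \<le> (\<Sum>l\<in>{i..<j}. ?E l)" using E by (intro sum_mono2) auto
  finally have potential: "of_int (j - i - 1) * (M * m / real n) \<le> C" using EC by linarith
  have "M * m * ((\<beta> - \<alpha>)\<^sup>2 - 2 * C / real n) \<le> M * m * ((2 * C / real n) * of_int (j - i - 1))"
    using kinetic M(2) m(2) by (intro mult_left_mono) auto
  also have "\<dots> = 2 * C * (of_int (j - i - 1) * (M * m / real n))" by simp
  also have "\<dots> \<le> 2 * C * C" using potential \<open>C \<ge> 0\<close> by (intro mult_left_mono) auto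
  finally show ?thesis by (simp add: power2_eq_square)
qed

section \<open>Minimisers under pointwise constraints\<close>

text \<open>At an end of the interval only inward variations are admissible, so each sign of the
  derivative has its own condition; at interior points the two combine to
  \<open>D = 0\<close>.\<close>

lemma interval_minimum_derivative:
  fixes f :: "real \<Rightarrow> real"
  assumes der: "(f has_real_derivative D) (at y)" and y: "a \<le> y" "y \<le> c"
    and min: "\<And>z. a \<le> z \<Longrightarrow> z \<le> c \<Longrightarrow> f y \<le> f z"
  shows "y < c \<Longrightarrow> D \<ge> 0" "a < y \<Longrightarrow> D \<le> 0"
proof -
  show "D \<ge> 0" if "y < c"
  proof (rule ccontr)
    assume "\<not> D \<ge> 0"
    then obtain d where d: "d > 0" "\<And>h. 0 < h \<Longrightarrow> h < d \<Longrightarrow> f (y + h) < f y"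
      using DERIV_neg_dec_right[OF der] by auto
    define h where "h = min (d / 2) (c - y)"
    have "0 < h" "h < d" "y + h \<le> c" using d(1) that by (auto simp: h_def min_def)
    then show False using d(2)[of h] min[of "y + h"] y by simp
  qed
  show "D \<le> 0" if "a < y"
  proof (rule ccontr)
    assume "\<not> D \<le> 0"
    then obtain d where d: "d > 0" "\<And>h. 0 < h \<Longrightarrow> h < d \<Longrightarrow> f (y - h) < f y"
      using DERIV_pos_inc_left[OF der] by auto
    define h where "h = min (d / 2) (y - a)"
    have "0 < h" "h < d" "a \<le> y - h" using d(1) that by (auto simp: h_def min_def)
    then show False using d(2)[of h] min[of "y - h"] y by simp
  qed
qed

text \<open>The action is continuous on a compact product and is therefore minimised. The ramp used
  as competitor rests in the wells outside times \<open>[-1,1]\<close>, which is why the energy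
  bound depends neither on the mesh nor on the window \<open>N\<close>.\<close>

lemma lattice_minimiser_exists:
  fixes b V V1 :: "real \<Rightarrow> real"
  assumes n: "n > 0" "int n \<le> N"
    and V: "\<And>y. (V has_real_derivative V1 y) (at y)" "V (-1) = 0" "V 1 = 0" "V1 (-1) = 0" "V1 1 = 0"
    and P: "\<And>s y. \<bar>s\<bar> \<le> 1 \<Longrightarrow> \<bar>y\<bar> \<le> 1 \<Longrightarrow> b s * V y \<le> P"
  obtains X where "\<And>k. \<bar>X k\<bar> \<le> 1" "\<And>k. k \<le> - N \<Longrightarrow> X k = -1" "\<And>k. N \<le> k \<Longrightarrow> X k = 1"
    "(\<Sum>l\<in>{-N..<N}. lattice_energy b V n X l) \<le> 1 + 2 * P"
    "\<And>k. \<bar>k\<bar> < N \<Longrightarrow> real n * (real n * (X (k + 1) - X k) - real n * (X k - X (k - 1)))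
             = b (of_int k / real n) * V1 (X k)"
proof -
  \<comment> \<open>Boundary values and constraint are both encoded as factors of a product,
    singletons for the tails, so that Tychonoff applies.\<close>
  define K where "K = PiE UNIV (\<lambda>k::int. if k \<le> - N then {-1} else if N \<le> k then {1} else {-1..1::real})"
  define A where "A X = (\<Sum>l\<in>{-N..<N}. lattice_energy b V n X l)" for X
  have K: "X \<in> K \<longleftrightarrow> (\<forall>k. \<bar>X k\<bar> \<le> 1 \<and> (k \<le> -N \<longrightarrow> X k = -1) \<and> (N \<le> k \<longrightarrow> X k = 1))" for X
  proof -
    have "X k \<in> (if k \<le> - N then {-1} else if N \<le> k then {1} else {-1..1})
        \<longleftrightarrow> \<bar>X k\<bar> \<le> 1 \<and> (k \<le> -N \<longrightarrow> X k = -1) \<and> (N \<le> k \<longrightarrow> X k = 1)" for k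
    proof -
      have "\<not> (k \<le> - N \<and> N \<le> k)" using n by linarith
      then show ?thesis by (cases "k \<le> - N"; cases "N \<le> k") (auto simp: abs_le_iff)
    qed
    then show ?thesis unfolding K_def PiE_UNIV_domain Pi_iff by simp
  qed
  \<comment> \<open>The ramp of slope 1 between times \<open>-1\<close> and \<open>1\<close>. It has
    \<open>2 * n\<close> active cells, each with kinetic part \<open>1 / (2 * n)\<close> and
    potential part at most \<open>P / n\<close>.\<close>
  define Y where "Y k = max (-1) (min 1 (of_int k / real n))" for k :: int
  have Y1: "\<bar>Y k\<bar> \<le> 1" for k by (auto simp: Y_def abs_le_iff)
  have low: "Y k = -1" if "k \<le> - int n" for k
  proof -
    have "of_int k \<le> - real n" using that by linarith
    then have "of_int k / real n \<le> -1" using n by (simp add: pos_divide_le_eq)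
    then show ?thesis by (simp add: Y_def)
  qed
  have high: "Y k = 1" if "int n \<le> k" for k
  proof -
    have "real n \<le> of_int k" using that by linarith
    then have "1 \<le> of_int k / real n" using n by (simp add: pos_le_divide_eq)
    then show ?thesis by (simp add: Y_def)
  qed
  have "Y \<in> K"
    unfolding K using Y1 low high n by auto
  have "compactin (product_topology (\<lambda>_. euclidean) UNIV) K"
    unfolding K_def compactin_PiE by auto
  then have "compact K" by (simp add: euclidean_product_topology)
  moreover have "continuous_on K A"
  proof -
    have "continuous_on UNIV V" using V(1) by (meson DERIV_continuous continuous_at_imp_continuous_on)
    then have "continuous_on UNIV (\<lambda>X. V (X l))" for l :: int
      by (rule continuous_on_compose2) auto
    then have "continuous_on UNIV A"
      unfolding A_def lattice_energy_def using n by (intro continuous_intros) auto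
    then show ?thesis by (rule continuous_on_subset) simp
  qed
  ultimately obtain X where X: "X \<in> K" and X_min: "\<And>Z. Z \<in> K \<Longrightarrow> A X \<le> A Z"
    using continuous_attains_inf[of K A] \<open>Y \<in> K\<close> by blast
  have "A Y \<le> 1 + 2 * P"
  proof -
    have mid: "Y k = of_int k / real n" if "- int n \<le> k" "k \<le> int n" for k
    proof -
      have "- real n \<le> of_int k" "of_int k \<le> real n" using that by linarith+
      then show ?thesis using n by (simp add: Y_def pos_le_divide_eq)
    qed
    have "A Y = (\<Sum>l\<in>{-int n..<int n}. lattice_energy b V n Y l)"
      unfolding A_def
    proof (rule sum.mono_neutral_right)
      show "\<forall>l\<in>{-N..<N} - {-int n..<int n}. lattice_energy b V n Y l = 0"
        using low high V by (auto simp: lattice_energy_def not_le not_less)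
    qed (use n in auto)
    also have "\<dots> \<le> (\<Sum>l\<in>{-int n..<int n}. (1/2 + P) / real n)"
    proof (rule sum_mono)
      fix l assume l: "l \<in> {-int n..<int n}"
      then have "Y (l + 1) - Y l = 1 / real n"
        using n by (simp add: mid diff_divide_distrib[symmetric])
      then have "real n * (Y (l + 1) - Y l)\<^sup>2 / 2 = 1 / 2 / real n"
        using n by (simp add: power2_eq_square)
      moreover have "\<bar>of_int l / real n\<bar> \<le> 1"
        using Y1[of l] l by (simp add: mid)
      then have "b (of_int l / real n) * V (Y l) / real n \<le> P / real n"
        using P Y1 by (intro divide_right_mono) auto
      ultimately show "lattice_energy b V n Y l \<le> (1/2 + P) / real n"
        unfolding lattice_energy_def by (simp add: add_divide_distrib)
    qed
    also have "\<dots> = 1 + 2 * P" using n by (simp add: field_simps)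
    finally show ?thesis .
  qed
  then have energy: "A X \<le> 1 + 2 * P" using X_min[OF \<open>Y \<in> K\<close>] by linarith
  have EL: "real n * (real n * (X (k + 1) - X k) - real n * (X k - X (k - 1)))
             = b (of_int k / real n) * V1 (X k)" if k: "\<bar>k\<bar> < N" for k
  proof -
    let ?I = "{-N..<N}"
    \<comment> \<open>\<open>f\<close> is the action as a function of the value at site
      \<open>k\<close> alone; \<open>r\<close> collects everything independent of it, including the
      potential of cell \<open>k - 1\<close>. Both affected cells lie in the window because
      \<open>\<bar>k\<bar> < N\<close>.\<close>
    define r where "r = (\<Sum>l\<in>?I - {k - 1, k}. lattice_energy b V n X l)
        + b (of_int (k - 1) / real n) * V (X (k - 1)) / real n"
    define f where "f y = r + real n * (y - X (k - 1))\<^sup>2 / 2 + real n * (X (k + 1) - y)\<^sup>2 / 2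
        + b (of_int k / real n) * V y / real n" for y
    have f: "A (X(k := y)) = f y" for y
    proof -
      have "A (X(k := y)) = (\<Sum>l\<in>?I - {k - 1, k}. lattice_energy b V n (X(k := y)) l)
          + (\<Sum>l\<in>{k - 1, k}. lattice_energy b V n (X(k := y)) l)"
        unfolding A_def using k by (intro sum.subset_diff) auto
      also have "(\<Sum>l\<in>?I - {k - 1, k}. lattice_energy b V n (X(k := y)) l)
          = (\<Sum>l\<in>?I - {k - 1, k}. lattice_energy b V n X l)"
        by (rule sum.cong) (auto simp: lattice_energy_def)
      finally show ?thesis by (simp add: f_def r_def lattice_energy_def fun_upd_def)
    qed
    define D where "D = real n * (X k - X (k - 1)) - real n * (X (k + 1) - X k) + b (of_int k / real n) * V1 (X k) / real n"
    have der: "(f has_real_derivative D) (at (X k))"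
      unfolding f_def D_def using n by (auto intro!: derivative_eq_intros V(1) simp: field_simps)
    have min: "f (X k) \<le> f y" if "-1 \<le> y" "y \<le> 1" for y
    proof -
      have "X(k := y) \<in> K" using X that k unfolding K by (auto simp: abs_le_iff)
      then show ?thesis using X_min[of "X(k := y)"] f[of y] f[of "X k"] by simp
    qed
    have X1: "-1 \<le> X l" "X l \<le> 1" for l
      using X by (simp_all add: K abs_le_iff minus_le_iff[of "X l"])
    note sign = interval_minimum_derivative[OF der X1 min]
    have "D = 0"
    proof -
      \<comment> \<open>At a wall the constraint only gives one sign; the other one comes from \<open>V1 (\<plusminus>1) = 0\<close> and the fact that
        the neighbours do not lie beyond the wall.\<close>
      have "D \<ge> 0" if "X k = 1"
        using X1[of "k - 1"] X1[of "k + 1"] that V(5) n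
        by (simp add: D_def mult_nonneg_nonpos flip: right_diff_distrib)
      moreover have "D \<le> 0" if "X k = -1"
        using X1[of "k - 1"] X1[of "k + 1"] that V(4) n
        by (simp add: D_def mult_nonneg_nonpos flip: right_diff_distrib)
      ultimately show ?thesis using sign X1[of k] by (cases "X k = 1"; cases "X k = -1") auto
    qed
    then have "real n * D = 0" by simp
    then show ?thesis using n by (simp add: D_def algebra_simps)
  qed
  show thesis
    using that[of X] X energy EL unfolding K A_def by blast
qed

text \<open>On \<open>[\<alpha>,\<beta>]\<close> the potential has a positive minimum, and
  coercivity makes \<open>b\<close> as large as desired at late times, so
  \<open>crossing_cost\<close> excludes energy at most \<open>C\<close>. The time \<open>T\<close>
  is chosen before \<open>n\<close> and \<open>X\<close>, and the absolute value serves both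
  tails.\<close>

lemma late_crossing_expensive:
  fixes b V :: "real \<Rightarrow> real"
  assumes b: "\<And>t. b t \<ge> 0" "filterlim b at_top at_infinity"
    and V: "continuous_on UNIV V" "\<And>y. V y \<ge> 0" "\<And>y. \<alpha> \<le> y \<Longrightarrow> y \<le> \<beta> \<Longrightarrow> V y > 0"
    and "\<alpha> < \<beta>"
  obtains T where "\<forall>\<^sub>F n in sequentially. \<forall>X i j. i \<le> j \<longrightarrow> (\<forall>l. i \<le> l \<longrightarrow> l \<le> j \<longrightarrow> T \<le> \<bar>of_int l / real n\<bar>)
      \<longrightarrow> X i \<le> \<alpha> \<longrightarrow> \<beta> \<le> X j \<longrightarrow> C < (\<Sum>l\<in>{i..<j}. lattice_energy b V n X l)"
proof -
  obtain y0 where y0: "\<alpha> \<le> y0" "y0 \<le> \<beta>" and m: "\<And>y. \<alpha> \<le> y \<Longrightarrow> y \<le> \<beta> \<Longrightarrow> V y0 \<le> V y"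
    using continuous_attains_inf[of "{\<alpha>..\<beta>}" V] continuous_on_subset[OF V(1)] \<open>\<alpha> < \<beta>\<close> by auto
  define m where "m = V y0"
  have "m > 0" using V(3) y0 by (simp add: m_def)
  define d where "d = (\<beta> - \<alpha>)\<^sup>2"
  have "d > 0" using \<open>\<alpha> < \<beta>\<close> by (simp add: d_def)
  \<comment> \<open>Chosen so that \<open>M * m * (d / 2)\<close> exceeds the bound
    \<open>2 * C\<^sup>2\<close>; the other half of \<open>d\<close> is given up to the mesh
    correction, which \<open>real n > 4 * C / d\<close> makes small enough.\<close>
  define M where "M = 4 * (C\<^sup>2 + 1) / (m * d)"
  have M: "M > 0" "M * m * (d / 2) = 2 * C\<^sup>2 + 2"
    using \<open>m > 0\<close> \<open>d > 0\<close> by (simp_all add: M_def add_pos_nonneg add_nonneg_pos field_simps)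
  obtain T where T: "\<And>t. T \<le> \<bar>t\<bar> \<Longrightarrow> M \<le> b t"
    using b(2) by (auto simp: filterlim_at_top eventually_at_infinity)
  have "\<forall>\<^sub>F n in sequentially. n > 0 \<and> real n > 4 * C / d"
    by (intro eventually_conj eventually_gt_at_top eventually_real_gt order_refl)
  then have "\<forall>\<^sub>F n in sequentially. \<forall>X i j. i \<le> j \<longrightarrow> (\<forall>l. i \<le> l \<longrightarrow> l \<le> j \<longrightarrow> T \<le> \<bar>of_int l / real n\<bar>)
      \<longrightarrow> X i \<le> \<alpha> \<longrightarrow> \<beta> \<le> X j \<longrightarrow> C < (\<Sum>l\<in>{i..<j}. lattice_energy b V n X l)"
  proof eventually_elim
    case (elim n)
    show ?case
    proof (intro allI impI, rule ccontr)
      fix X :: "int \<Rightarrow> real" and i j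
      assume *: "i \<le> j" "\<forall>l. i \<le> l \<longrightarrow> l \<le> j \<longrightarrow> T \<le> \<bar>of_int l / real n\<bar>" "X i \<le> \<alpha>" "\<beta> \<le> X j"
        and "\<not> C < (\<Sum>l\<in>{i..<j}. lattice_energy b V n X l)"
      then have "M * m * ((\<beta> - \<alpha>)\<^sup>2 - 2 * C / real n) \<le> 2 * C\<^sup>2"
        using elim \<open>\<alpha> < \<beta>\<close> b(1) V(2) T \<open>M > 0\<close> m \<open>m > 0\<close>
        by (intro crossing_cost[of n i j X \<alpha> \<beta> b V]) (auto simp: m_def)
      moreover have "2 * C / real n \<le> d / 2"
        using elim \<open>d > 0\<close> by (simp add: field_simps)
      then have "M * m * (d / 2) \<le> M * m * (d - 2 * C / real n)"
        using \<open>M > 0\<close> \<open>m > 0\<close> by (intro mult_left_mono) auto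
      ultimately show False using M(2) unfolding d_def by linarith
    qed
  qed
  then show thesis by (rule that)
qed

subsection \<open>The heteroclinic solution\<close>

text \<open>A Gronwall argument: \<open>E = y\<^sup>2 + w\<^sup>2\<close> satisfies
  \<open>\<bar>E'\<bar> \<le> c * E\<close> and vanishes at \<open>t0\<close>. The weight
  \<open>exp (- c * s)\<close> handles later times and \<open>exp (c * s)\<close> earlier
  ones.\<close>

lemma second_order_zero_unique:
  fixes y w g :: "real \<Rightarrow> real"
  assumes y: "\<And>t. (y has_real_derivative w t) (at t)"
    and w: "\<And>t. (w has_real_derivative g t) (at t)"
    and bound: "\<And>R. \<exists>K. \<forall>t. \<bar>t\<bar> \<le> R \<longrightarrow> \<bar>g t\<bar> \<le> K * \<bar>y t\<bar>"
    and zero: "y t0 = 0" "w t0 = 0"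
  shows "y t = 0"
proof -
  obtain K where K: "\<And>s. \<bar>s\<bar> \<le> max \<bar>t\<bar> \<bar>t0\<bar> \<Longrightarrow> \<bar>g s\<bar> \<le> K * \<bar>y s\<bar>" using bound by blast
  define c where "c = 1 + \<bar>K\<bar>"
  define E where "E s = (y s)\<^sup>2 + (w s)\<^sup>2" for s
  define E' where "E' s = 2 * y s * w s + 2 * w s * g s" for s
  have E: "(E has_real_derivative E' s) (at s)" for s
    unfolding E_def E'_def by (auto intro!: derivative_eq_intros y w)
  have E': "\<bar>E' s\<bar> \<le> c * E s" if "\<bar>s\<bar> \<le> max \<bar>t\<bar> \<bar>t0\<bar>" for s
  proof -
    have "\<bar>g s\<bar> \<le> \<bar>K\<bar> * \<bar>y s\<bar>"
      using K[OF that] by (meson abs_ge_self abs_ge_zero mult_right_mono order_trans)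
    then have "\<bar>w s\<bar> * \<bar>g s\<bar> \<le> \<bar>w s\<bar> * (\<bar>K\<bar> * \<bar>y s\<bar>)" by (rule mult_left_mono) simp
    moreover have "\<bar>E' s\<bar> \<le> 2 * (\<bar>y s\<bar> * \<bar>w s\<bar>) + 2 * (\<bar>w s\<bar> * \<bar>g s\<bar>)"
      unfolding E'_def by (rule order_trans[OF abs_triangle_ineq]) (simp add: abs_mult)
    ultimately have "\<bar>E' s\<bar> \<le> c * (2 * \<bar>y s\<bar> * \<bar>w s\<bar>)" by (simp add: c_def algebra_simps)
    also have "\<dots> \<le> c * E s"
      using sum_squares_bound[of "\<bar>y s\<bar>" "\<bar>w s\<bar>"] by (intro mult_left_mono) (auto simp: E_def c_def)
    finally show ?thesis .
  qed
  have E0: "E t0 = 0" using zero by (simp add: E_def)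
  have "E t \<le> 0"
  proof (cases "t0 \<le> t")
    case True
    have "E t * exp (- c * t) \<le> E t0 * exp (- c * t0)"
    proof (rule DERIV_nonpos_imp_nonincreasing[OF True])
      fix s assume s: "t0 \<le> s" "s \<le> t"
      have "((\<lambda>s. E s * exp (- c * s)) has_real_derivative (E' s - c * E s) * exp (- c * s)) (at s)"
        by (auto intro!: derivative_eq_intros E simp: algebra_simps)
      moreover have "\<bar>s\<bar> \<le> max \<bar>t\<bar> \<bar>t0\<bar>" using s by linarith
      then have "E' s - c * E s \<le> 0" using E'[of s] by linarith
      ultimately show "\<exists>D. ((\<lambda>s. E s * exp (- c * s)) has_real_derivative D) (at s) \<and> D \<le> 0"
        by (meson exp_ge_zero mult_nonpos_nonneg)
    qed
    then show ?thesis by (simp add: E0 mult_le_0_iff not_le[symmetric])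
  next
    case False
    then have "t \<le> t0" by simp
    have "E t * exp (c * t) \<le> E t0 * exp (c * t0)"
    proof (rule DERIV_nonneg_imp_nondecreasing[OF \<open>t \<le> t0\<close>])
      fix s assume s: "t \<le> s" "s \<le> t0"
      have "((\<lambda>s. E s * exp (c * s)) has_real_derivative (E' s + c * E s) * exp (c * s)) (at s)"
        by (auto intro!: derivative_eq_intros E simp: algebra_simps)
      moreover have "\<bar>s\<bar> \<le> max \<bar>t\<bar> \<bar>t0\<bar>" using s by linarith
      then have "E' s + c * E s \<ge> 0" using E'[of s] by linarith
      ultimately show "\<exists>D. ((\<lambda>s. E s * exp (c * s)) has_real_derivative D) (at s) \<and> 0 \<le> D"
        by (meson exp_ge_zero mult_nonneg_nonneg)
    qed
    then show ?thesis by (simp add: E0 mult_le_0_iff not_le[symmetric])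
  qed
  then have "(y t)\<^sup>2 \<le> 0" unfolding E_def using zero_le_power2[of "w t"] by linarith
  then show ?thesis by simp
qed

text \<open>On the reals \<open>INF\<close> bounds the values only if the range is bounded below;
  this is what lets a positive infimum be read as positivity of \<open>a\<close>.\<close>

lemma coercive_bdd_below:
  fixes a :: "real \<Rightarrow> real"
  assumes "continuous_on UNIV a" "filterlim a at_top at_infinity"
  shows "bdd_below (range a)"
proof -
  obtain T where T: "\<And>t. T \<le> \<bar>t\<bar> \<Longrightarrow> 0 \<le> a t"
    using assms(2) by (auto simp: filterlim_at_top eventually_at_infinity)
  have "bdd_below (a ` {-T..T})"
    using compact_continuous_image[OF continuous_on_subset[OF assms(1)] compact_Icc]
    by (intro bounded_imp_bdd_below compact_imp_bounded) auto
  moreover have "bdd_below (a ` {t. T \<le> \<bar>t\<bar>})" using T by (auto intro!: bdd_belowI[of _ 0])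
  ultimately have "bdd_below (a ` {-T..T} \<union> a ` {t. T \<le> \<bar>t\<bar>})" by simp
  moreover have "range a \<subseteq> a ` {-T..T} \<union> a ` {t. T \<le> \<bar>t\<bar>}" by force
  ultimately show ?thesis by (rule bdd_below_mono)
qed

text \<open>The boundary values of the approximations move off to infinity, so the limits of
  \<open>x\<close> have to come from the uniform energy bound.\<close>

lemma heteroclinic_exists:
  fixes b V V1 V2 :: "real \<Rightarrow> real"
  assumes b: "continuous_on UNIV b" "\<And>t. b t \<ge> 0" "filterlim b at_top at_infinity"
    and V: "\<And>y. (V has_real_derivative V1 y) (at y)"
    and V1: "\<And>y. (V1 has_real_derivative V2 y) (at y)"
    and V2: "continuous_on UNIV V2"
    and V_nonneg: "\<And>y. V y \<ge> 0" and V_wells: "V (-1) = 0" "V 1 = 0"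
    and V_pos: "\<And>y. -1 < y \<Longrightarrow> y < 1 \<Longrightarrow> V y > 0"
  obtains x w where "\<And>t. (x has_real_derivative w t) (at t)"
    "\<And>t. (w has_real_derivative b t * V1 (x t)) (at t)"
    "(x \<longlongrightarrow> -1) at_bot" "(x \<longlongrightarrow> 1) at_top" "\<And>t. -1 < x t \<and> x t < 1"
proof -
  have V_cont: "continuous_on UNIV V" and V1_cont: "continuous_on UNIV V1"
    using V V1 by (meson DERIV_continuous continuous_at_imp_continuous_on)+
  \<comment> \<open>The wells are global minima of \<open>V\<close>.\<close>
  have crit: "V1 (-1) = 0" "V1 1 = 0"
    using DERIV_local_min[OF V zero_less_one] V_nonneg V_wells by metis+
  obtain P where P: "\<And>s y. \<bar>s\<bar> \<le> 1 \<Longrightarrow> \<bar>y\<bar> \<le> 1 \<Longrightarrow> \<bar>b s * V y\<bar> \<le> P"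
    using continuous_product_bounded[OF b(1) V_cont, of 1 1] by blast
  define C where "C = 1 + 2 * P"
  \<comment> \<open>With mesh \<open>1 / n\<close>, \<open>n * n\<close> sites reach time
    \<open>n\<close>, so the windows exhaust the line.\<close>
  define N where "N n = int n * int n" for n
  define minimiser where "minimiser n X \<longleftrightarrow> (\<forall>k. k \<le> - N n \<longrightarrow> X k = -1) \<and> (\<forall>k. N n \<le> k \<longrightarrow> X k = 1)
      \<and> (\<Sum>l\<in>{-N n..<N n}. lattice_energy b V n X l) \<le> C
      \<and> (\<forall>k. \<bar>k\<bar> < N n \<longrightarrow> real n * (real n * (X (k + 1) - X k) - real n * (X k - X (k - 1)))
             = b (of_int k / real n) * V1 (X k))" for n X
  have "\<exists>X. (\<forall>k. \<bar>X k\<bar> \<le> 1) \<and> (n > 0 \<longrightarrow> minimiser n X)" for n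
  proof (cases "n > 0")
    case True
    then have "int n \<le> N n" by (simp add: N_def)
    from True this V V_wells crit P[THEN abs_le_D1] show ?thesis
      by (rule lattice_minimiser_exists[of n "N n" V V1 b P])
        (auto simp: minimiser_def C_def)
  next
    \<comment> \<open>A dummy value at \<open>n = 0\<close> keeps the bound
      \<open>\<bar>X n k\<bar> \<le> 1\<close> valid for every \<open>n\<close>.\<close>
    case False
    then show ?thesis by (intro exI[of _ "\<lambda>_. 0"]) simp
  qed
  then obtain X where X: "\<And>n. (\<forall>k. \<bar>X n k\<bar> \<le> 1) \<and> (n > 0 \<longrightarrow> minimiser n (X n))"
    by metis
  have X1: "\<bar>X n k\<bar> \<le> 1" for n k using X by blast
  have X_left: "X n k = -1" if "n > 0" "k \<le> - N n" for n k
    using X[of n] that by (simp add: minimiser_def)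
  have X_right: "X n k = 1" if "n > 0" "N n \<le> k" for n k
    using X[of n] that by (simp add: minimiser_def)
  have energy: "(\<Sum>l\<in>{-N n..<N n}. lattice_energy b V n (X n) l) \<le> C" if "n > 0" for n
    using X[of n] that by (simp add: minimiser_def)
  have EL: "real n * (real n * (X n (k + 1) - X n k) - real n * (X n k - X n (k - 1)))
      = b (of_int k / real n) * V1 (X n k)" if "n > 0" "\<bar>k\<bar> < N n" for n k
    using X[of n] that unfolding minimiser_def by blast
  have energy_part: "(\<Sum>l\<in>{i..<j}. lattice_energy b V n (X n) l) \<le> C"
    if "n > 0" "- N n \<le> i" "j \<le> N n" for n i j
  proof (rule order_trans[OF sum_mono2 energy[OF that(1)]])
    show "0 \<le> lattice_energy b V n (X n) l" for l using b(2) V_nonneg by (rule lattice_energy_nonneg)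
  qed (use that in auto)
  define v where "v n k = real n * (X n (k + 1) - X n k)" for n k
  have eq: "\<forall>\<^sub>F n in sequentially. \<forall>k. \<bar>of_int k\<bar> \<le> R * real n
               \<longrightarrow> real n * (v n (k + 1) - v n k) = b (of_int (k + 1) / real n) * V1 (X n (k + 1))" for R
  proof -
    have "\<forall>\<^sub>F n in sequentially. n > 0 \<and> real n > R + 1"
      by (intro eventually_conj eventually_gt_at_top eventually_real_gt order_refl)
    then show ?thesis
    proof eventually_elim
      case (elim n)
      show ?case
      proof (intro allI impI)
        fix k :: int assume k: "\<bar>of_int k\<bar> \<le> R * real n"
        have "real 1 \<le> real n" using elim by linarith
        then have "of_int \<bar>k + 1\<bar> \<le> (R + 1) * real n" using k by (simp add: algebra_simps)
        also have "\<dots> < real n * real n" using elim by (intro mult_strict_right_mono) auto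
        also have "\<dots> = of_int (N n)" by (simp add: N_def)
        finally have "\<bar>k + 1\<bar> < N n" by linarith
        then show "real n * (v n (k + 1) - v n k) = b (of_int (k + 1) / real n) * V1 (X n (k + 1))"
          using EL[of n "k + 1"] elim by (simp add: v_def)
      qed
    qed
  qed
  obtain F x w where F: "F \<noteq> bot" "F \<le> sequentially"
    and lim: "\<And>t. ((\<lambda>n. X n \<lfloor>real n * t\<rfloor>) \<longlongrightarrow> x t) F"
    and x: "\<And>t. (x has_real_derivative w t) (at t)"
    and w: "\<And>t. (w has_real_derivative b t * V1 (x t)) (at t)"
    using lattice_solutions_accumulate[OF b(1) V1_cont X1 v_def eq] by blast
  have "\<bar>x t\<bar> \<le> 1" for t
    using tendsto_upperbound[OF tendsto_rabs[OF lim] _ F(1)] X1 by simp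
  then have x1: "-1 \<le> x t" "x t \<le> 1" for t
    by (simp_all add: abs_le_iff minus_le_iff[of "x t"])

  \<comment> \<open>If a minimiser were at most \<open>1 - e\<close> at a late time, it would still
    have to climb to the value 1 pinned at \<open>N n\<close>. This late crossing would cost more
    than the available energy \<open>C\<close>.\<close>
  have right: "\<exists>T. \<forall>t\<ge>T. 1 - e \<le> x t" if e: "0 < e" "e < 1" for e
  proof -
    obtain T where T: "\<forall>\<^sub>F n in sequentially. \<forall>X i j. i \<le> j \<longrightarrow> (\<forall>l. i \<le> l \<longrightarrow> l \<le> j \<longrightarrow> T \<le> \<bar>of_int l / real n\<bar>)
      \<longrightarrow> X i \<le> 1 - e \<longrightarrow> 1 - e / 2 \<le> X j \<longrightarrow> C < (\<Sum>l\<in>{i..<j}. lattice_energy b V n X l)"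
      by (rule late_crossing_expensive[OF b(2,3) V_cont V_nonneg, of "1 - e" "1 - e/2"])
        (use e in \<open>auto intro!: V_pos\<close>)
    \<comment> \<open>The extra 1 covers the rounding of \<open>real n * t\<close>, which loses at
      most \<open>1 / n\<close> of time.\<close>
    have "1 - e \<le> x t" if t: "\<bar>T\<bar> + 1 \<le> t" for t
    proof (rule tendsto_lowerbound[OF lim _ F(1)])
      have "\<forall>\<^sub>F n in sequentially. n > 0 \<and> real n > t"
        by (intro eventually_conj eventually_gt_at_top eventually_real_gt order_refl)
      then have "\<forall>\<^sub>F n in sequentially. 1 - e \<le> X n \<lfloor>real n * t\<rfloor>"
        using T
      proof eventually_elim
        case (elim n)
        let ?i = "\<lfloor>real n * t\<rfloor>"
        have n: "n > 0" using elim by simp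
        have "real n * t \<le> real n * real n" using elim by (intro mult_left_mono) auto
        then have iN: "?i \<le> N n" unfolding N_def by (simp add: floor_le_iff)
        have "0 \<le> real n * t" using t by simp
        then have "0 \<le> ?i" by simp
        moreover have "0 \<le> N n" by (simp add: N_def)
        ultimately have Ni: "- N n \<le> ?i" by linarith
        have "T \<le> \<bar>of_int l / real n\<bar>" if "?i \<le> l" for l
        proof -
          have "real 1 \<le> real n" using n by linarith
          then have "real n * (t - 1) \<le> real n * t - 1" by (simp add: algebra_simps)
          also have "\<dots> \<le> of_int l" using that by linarith
          finally have "t - 1 \<le> of_int l / real n" using n by (simp add: pos_le_divide_eq mult.commute)
          then show ?thesis using t by linarith
        qed
        then have "C < (\<Sum>l\<in>{?i..<N n}. lattice_energy b V n (X n) l)" if "X n ?i \<le> 1 - e"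
          using elim(2) iN that X_right[OF n, of "N n"] e by auto
        then show ?case using energy_part[OF n Ni order_refl] by linarith
      qed
      then show "\<forall>\<^sub>F n in F. 1 - e \<le> X n \<lfloor>real n * t\<rfloor>" by (rule filter_leD[OF F(2)])
    qed
    then show ?thesis by blast
  qed
  \<comment> \<open>Here the upward crossing starts from the value \<open>-1\<close> pinned at
    \<open>- N n\<close>.\<close>
  have left: "\<exists>T. \<forall>t\<le>T. x t \<le> -1 + e" if e: "0 < e" "e < 1" for e
  proof -
    obtain T where T: "\<forall>\<^sub>F n in sequentially. \<forall>X i j. i \<le> j \<longrightarrow> (\<forall>l. i \<le> l \<longrightarrow> l \<le> j \<longrightarrow> T \<le> \<bar>of_int l / real n\<bar>)
      \<longrightarrow> X i \<le> -1 + e / 2 \<longrightarrow> -1 + e \<le> X j \<longrightarrow> C < (\<Sum>l\<in>{i..<j}. lattice_energy b V n X l)"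
      by (rule late_crossing_expensive[OF b(2,3) V_cont V_nonneg, of "-1 + e/2" "-1 + e"])
        (use e in \<open>auto intro!: V_pos\<close>)
    \<comment> \<open>Rounding down moves further into the left tail, so no margin is
      required.\<close>
    have "x t \<le> -1 + e" if t: "t \<le> - \<bar>T\<bar>" for t
    proof (rule tendsto_upperbound[OF lim _ F(1)])
      have "\<forall>\<^sub>F n in sequentially. n > 0 \<and> real n > - t"
        by (intro eventually_conj eventually_gt_at_top eventually_real_gt order_refl)
      then have "\<forall>\<^sub>F n in sequentially. X n \<lfloor>real n * t\<rfloor> \<le> -1 + e"
        using T
      proof eventually_elim
        case (elim n)
        let ?j = "\<lfloor>real n * t\<rfloor>"
        have n: "n > 0" using elim by simp
        have "real n * (- real n) \<le> real n * t" using elim by (intro mult_left_mono) auto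
        then have Nj: "- N n \<le> ?j" unfolding N_def by (simp add: le_floor_iff)
        have "real n * t \<le> 0" using t by (simp add: mult_nonneg_nonpos)
        then have "?j \<le> 0" by linarith
        moreover have "0 \<le> N n" by (simp add: N_def)
        ultimately have jN: "?j \<le> N n" by linarith
        have "T \<le> \<bar>of_int l / real n\<bar>" if "l \<le> ?j" for l
        proof -
          have "of_int l \<le> real n * t" using that by linarith
          then have "of_int l / real n \<le> t" using n by (simp add: pos_divide_le_eq mult.commute)
          then show ?thesis using t by linarith
        qed
        then have "C < (\<Sum>l\<in>{- N n..<?j}. lattice_energy b V n (X n) l)" if "-1 + e \<le> X n ?j"
          using elim(2) Nj that X_left[OF n, of "- N n"] e by auto
        then show ?case using energy_part[OF n order_refl jN] by linarith
      qed
      then show "\<forall>\<^sub>F n in F. X n \<lfloor>real n * t\<rfloor> \<le> -1 + e" by (rule filter_leD[OF F(2)])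
    qed
    then show ?thesis by blast
  qed
  have top: "(x \<longlongrightarrow> 1) at_top"
  proof (rule tendstoI)
    fix e :: real assume "e > 0"
    \<comment> \<open>Halving \<open>min e 1\<close> satisfies the restriction to values below 1 and
      leaves a strict inequality with \<open>e\<close>.\<close>
    then have "0 < min e 1 / 2" "min e 1 / 2 < 1" "min e 1 / 2 < e" by auto
    with right[of "min e 1 / 2"] obtain T where "\<And>t. T \<le> t \<Longrightarrow> 1 - min e 1 / 2 \<le> x t" by blast
    then show "\<forall>\<^sub>F t in at_top. dist (x t) 1 < e"
      using x1 \<open>min e 1 / 2 < e\<close> unfolding eventually_at_top_linorder dist_real_def
      by (smt (verit))
  qed
  have bot: "(x \<longlongrightarrow> -1) at_bot"
  proof (rule tendstoI)
    fix e :: real assume "e > 0"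
    then have "0 < min e 1 / 2" "min e 1 / 2 < 1" "min e 1 / 2 < e" by auto
    with left[of "min e 1 / 2"] obtain T where "\<And>t. t \<le> T \<Longrightarrow> x t \<le> -1 + min e 1 / 2" by blast
    then show "\<forall>\<^sub>F t in at_bot. dist (x t) (-1) < e"
      using x1 \<open>min e 1 / 2 < e\<close> unfolding eventually_at_bot_linorder dist_real_def
      by (smt (verit))
  qed

  \<comment> \<open>\<open>V1\<close> is Lipschitz on \<open>[-1,1]\<close> since \<open>V2\<close>
    is bounded there, so the acceleration of \<open>x - c\<close> is controlled by
    \<open>\<bar>x - c\<bar>\<close> and the solution cannot leave the equilibrium.\<close>
  have const: "x t = c" if c: "V1 c = 0" "\<bar>c\<bar> \<le> 1" and t0: "x t0 = c" "w t0 = 0" for c t0 t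
  proof -
    obtain Q where Q: "\<And>y. \<bar>y\<bar> \<le> 1 \<Longrightarrow> \<bar>V2 y\<bar> \<le> Q"
      using continuous_bounded_symmetric_interval[OF V2] by blast
    have lip: "\<bar>V1 y\<bar> \<le> Q * \<bar>y - c\<bar>" if "\<bar>y\<bar> \<le> 1" for y
    proof -
      have "norm (V1 y - V1 c) \<le> Q * norm (y - c)"
      proof (rule field_differentiable_bound[of "{-1..1}" V1 V2])
        show "(V1 has_field_derivative V2 z) (at z within {-1..1})" for z
          using V1 by (rule has_field_derivative_at_within)
        show "norm (V2 z) \<le> Q" if "z \<in> {-1..1}" for z using Q[of z] that by (simp add: abs_le_iff)
      qed (use that c in \<open>auto simp: abs_le_iff\<close>)
      then show ?thesis using c by simp
    qed
    have "x t - c = 0"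
    proof (rule second_order_zero_unique[of "\<lambda>t. x t - c" w "\<lambda>t. b t * V1 (x t)"])
      fix R :: real
      obtain B where B: "\<And>t. \<bar>t\<bar> \<le> R \<Longrightarrow> \<bar>b t\<bar> \<le> B"
        using continuous_bounded_symmetric_interval[OF b(1)] by blast
      have "\<bar>b t * V1 (x t)\<bar> \<le> (B * Q) * \<bar>x t - c\<bar>" if "\<bar>t\<bar> \<le> R" for t
      proof -
        have "\<bar>b t\<bar> * \<bar>V1 (x t)\<bar> \<le> B * (Q * \<bar>x t - c\<bar>)"
          using B[OF that] lip[of "x t"] x1[of t] by (intro mult_mono) auto
        then show ?thesis by (simp add: abs_mult mult.assoc)
      qed
      then show "\<exists>K. \<forall>t. \<bar>t\<bar> \<le> R \<longrightarrow> \<bar>b t * V1 (x t)\<bar> \<le> K * \<bar>x t - c\<bar>" by blast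
    qed (use t0 x w in \<open>auto intro!: derivative_eq_intros\<close>)
    then show ?thesis by simp
  qed
  \<comment> \<open>Touching 1 would be a maximum of \<open>x\<close>, hence with zero velocity; the
    solution would be constantly 1, against its limit \<open>-1\<close>.\<close>
  have "x t \<noteq> 1" for t
  proof
    assume "x t = 1"
    then have "w t = 0" using DERIV_local_max[OF x zero_less_one, of t] x1 by simp
    then have "x = (\<lambda>_. 1)" using const[OF crit(2) _ \<open>x t = 1\<close>] by auto
    then show False using bot by (simp add: tendsto_const_iff)
  qed
  moreover have "x t \<noteq> -1" for t
  proof
    assume "x t = -1"
    then have "w t = 0" using DERIV_local_min[OF x zero_less_one, of t] x1 by simp
    then have "x = (\<lambda>_. -1)" using const[OF crit(1) _ \<open>x t = -1\<close>] by auto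
    then show False using top by (simp add: tendsto_const_iff)
  qed
  ultimately have "-1 < x t \<and> x t < 1" for t using x1[of t] by (metis order_less_le)
  then show thesis using that x w bot top by blast
qed

text \<open>Every \<open>C^2\<close> function on the line lies in \<open>H^1_loc\<close>, so
  \<open>C2_with\<close> expresses both regularity claims.\<close>

theorem theorem5p1:
  fixes V V1 V2 a :: "real \<Rightarrow> real"
  assumes V_C2: "C2_with V V1 V2"
    and V_nonneg: "\<forall>x. V x \<ge> 0"
    and V_wells: "V (-1) = 0" "V 1 = 0"
    and V_pos: "\<forall>x. -1 < x \<and> x < 1 \<longrightarrow> V x > 0"
    and V_nondeg: "V2 (-1) > 0" "V2 1 > 0"
    and a_cont: "continuous_on UNIV a"
    and a_inf: "(INF t. a t) > 0"
    and a_coercive: "filterlim a at_top at_infinity"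
  shows "\<forall>\<epsilon>>0. \<exists>x x1 x2. C2_with x x1 x2 \<and>
           (\<forall>t. x2 t = a (\<epsilon> * t) * V1 (x t)) \<and>
           (x \<longlongrightarrow> -1) at_bot \<and> (x \<longlongrightarrow> 1) at_top \<and>
           (\<forall>t. -1 < x t \<and> x t < 1)"
proof (intro allI impI)
  fix \<epsilon> :: real assume \<epsilon>: "\<epsilon> > 0"
  define b where "b t = a (\<epsilon> * t)" for t
  have b_cont: "continuous_on UNIV b"
    unfolding b_def by (intro continuous_on_compose2[OF a_cont] continuous_intros) auto
  have "a t \<ge> 0" for t
    using cINF_lower[OF coercive_bdd_below[OF a_cont a_coercive], of t] a_inf by simp
  then have b_nonneg: "b t \<ge> 0" for t by (simp add: b_def)
  have "filterlim (\<lambda>t. \<epsilon> * t) at_infinity at_infinity"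
    unfolding filterlim_at_infinity_conv_norm_at_top using \<epsilon>
    by (simp add: abs_mult filterlim_tendsto_pos_mult_at_top[OF tendsto_const _ filterlim_norm_at_top[where 'a=real, unfolded real_norm_def]])
  then have b_coercive: "filterlim b at_top at_infinity"
    unfolding b_def by (rule filterlim_compose[OF a_coercive])
  have V: "\<And>y. (V has_real_derivative V1 y) (at y)" "\<And>y. (V1 has_real_derivative V2 y) (at y)"
    "continuous_on UNIV V2"
    using V_C2 by (auto simp: C2_with_def)
  obtain x w where x: "\<And>t. (x has_real_derivative w t) (at t)"
    "\<And>t. (w has_real_derivative b t * V1 (x t)) (at t)"
    "(x \<longlongrightarrow> -1) at_bot" "(x \<longlongrightarrow> 1) at_top" "\<And>t. -1 < x t \<and> x t < 1"
    using heteroclinic_exists[OF b_cont b_nonneg b_coercive V V_nonneg[rule_format] V_wells]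
      V_pos by blast
  \<comment> \<open>The equation itself supplies the second derivative, whose continuity follows
    from that of \<open>b\<close>, \<open>V1\<close> and \<open>x\<close>.\<close>
  have "continuous_on UNIV x" using x(1) by (meson DERIV_continuous continuous_at_imp_continuous_on)
  moreover have "continuous_on UNIV V1" using V(2) by (meson DERIV_continuous continuous_at_imp_continuous_on)
  ultimately have "continuous_on UNIV (\<lambda>t. b t * V1 (x t))"
    by (intro continuous_intros b_cont continuous_on_compose2[of UNIV V1 UNIV x]) auto
  then have "C2_with x w (\<lambda>t. b t * V1 (x t))" using x by (simp add: C2_with_def)
  then show "\<exists>x x1 x2. C2_with x x1 x2 \<and> (\<forall>t. x2 t = a (\<epsilon> * t) * V1 (x t)) \<and>
           (x \<longlongrightarrow> -1) at_bot \<and> (x \<longlongrightarrow> 1) at_top \<and> (\<forall>t. -1 < x t \<and> x t < 1)"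
    using x unfolding b_def by blast
qed

end
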